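(* Let $G \leq \mathrm{Sym}(n)$ be a permutation group with no fixpoints (no point of $\{1,\dots,n\}$ is fixed by every element of $G$) and assume that there is a permutation $\alpha \in G$ such that $\alpha$ has exactly one fixpoint and all other orbits of $\alpha$ have the same size. Then for every $k \in \mathbb{N}$ there is an algebra $\mathbf{A}_k$ such that: (1) $\mathbf{A}_k = (A_k, f_0,\ldots, f_k)$ with $(k+1)n<|A_k| < (k + 2) n$, and $f_0,\ldots, f_k$ are $n$-ary; (2) $\mathbf{A}_k$ is idempotent; (3) $\mathbf{A}_k$ satisfies $\Sigma_{\mathrm{Sym}(n)}$ on every $F\subseteq A_k^n$ with $|F|=k$; (4) $\mathbf{A}_k$ does not satisfy $\Sigma_G$.
   Context: An algebra $\mathbf{A} = (A,(f_i)_{i\in I})$ is a non-empty set $A$ with a list of finitary operations $f_i\colon A^{k_i}\to A$. It is idempotent if $f_i(x,x,\ldots,x)=x$ for all basic operations $f_i$ and all $x\in A$. $\mathsf{Clo}(\mathbf A)$ is the set of term operations of $\mathbf A$, i.e. all operations obtained by composing basic operations and projections. For a permutation group $H \leq \mathrm{Sym}(n)$ on $\{1,\dots,n\}$ and $t\colon A^n\to A$, write $t^\pi(x_1,\dots,x_n) = t(x_{\pi(1)},\dots,x_{\pi(n)})$ for $\pi\in H$. $\Sigma_H$ is the set of all identities $t\approx t^\pi$, $\pi\in H$, in one $n$-ary function symbol $t$. The algebra $\mathbf A$ satisfies $\Sigma_H$ if there is an $n$-ary $t\in\mathsf{Clo}(\mathbf A)$ with $t(\overline x)=t^\pi(\overline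 x)$ for all $\pi\in H$ and all $\overline x\in A^n$. For $F\subseteq A^n$, $\mathbf A$ satisfies $\Sigma_H$ on $F$ if there is an $n$-ary $t\in\mathsf{Clo}(\mathbf A)$ with $t(\overline x)=t^\pi(\overline x)$ for all $\pi\in H$ and all $\overline x\in F$. *)

theory Defs
  imports "HOL-Algebra.Sym_Groups" "HOL-Combinatorics.Orbits"
begin

text \<open>
  An \<open>n\<close>-tuple over \<open>A\<close> is a function on \<open>{1..n}\<close> with values in \<open>A\<close>, extended by
  \<^const>\<open>undefined\<close> outside \<open>{1..n}\<close>; thus equality and cardinality of sets of tuples
  are the usual ones.
\<close>

definition tuples :: "'a set \<Rightarrow> nat \<Rightarrow> (nat \<Rightarrow> 'a) set" where
  "tuples A n = ({1..n} \<rightarrow>\<^sub>E A)"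

record ('a, 'i) alg = "'a partial_object" +
  idx :: "'i set"
  arity :: "'i \<Rightarrow> nat"
  op :: "'i \<Rightarrow> (nat \<Rightarrow> 'a) \<Rightarrow> 'a"

definition is_algebra :: "('a, 'i) alg \<Rightarrow> bool" where
  "is_algebra A \<longleftrightarrow>
     carrier A \<noteq> {} \<and> (\<forall>i\<in>idx A. op A i \<in> tuples (carrier A) (arity A i) \<rightarrow> carrier A)"

definition is_idempotent :: "('a, 'i) alg \<Rightarrow> bool" where
  "is_idempotent A \<longleftrightarrow> (\<forall>i\<in>idx A. \<forall>x\<in>carrier A. op A i (\<lambda>j\<in>{1..arity A i}. x) = x)"

text \<open>The \<open>n\<close>-ary term operations; as operations on \<open>tuples (carrier A) n\<close> they are
  \<^const>\<open>undefined\<close> elsewhere.\<close>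

inductive_set clo :: "('a, 'i) alg \<Rightarrow> nat \<Rightarrow> ((nat \<Rightarrow> 'a) \<Rightarrow> 'a) set"
  for A :: "('a, 'i) alg" and n :: nat where
  proj: "j \<in> {1..n} \<Longrightarrow> (\<lambda>x\<in>tuples (carrier A) n. x j) \<in> clo A n"
| comp: "i \<in> idx A \<Longrightarrow> (\<And>j. j \<in> {1..arity A i} \<Longrightarrow> s j \<in> clo A n) \<Longrightarrow>
    (\<lambda>x\<in>tuples (carrier A) n. op A i (\<lambda>j\<in>{1..arity A i}. s j x)) \<in> clo A n"

definition perm_op :: "((nat \<Rightarrow> 'a) \<Rightarrow> 'a) \<Rightarrow> (nat \<Rightarrow> nat) \<Rightarrow> (nat \<Rightarrow> 'a) \<Rightarrow> 'a" where
  "perm_op t \<pi> x = t (\<lambda>i. x (\<pi> i))"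

definition satisfies_Sigma_on ::
  "('a, 'i) alg \<Rightarrow> nat \<Rightarrow> (nat \<Rightarrow> nat) set \<Rightarrow> (nat \<Rightarrow> 'a) set \<Rightarrow> bool" where
  "satisfies_Sigma_on A n H F \<longleftrightarrow> (\<exists>t\<in>clo A n. \<forall>\<pi>\<in>H. \<forall>x\<in>F. t x = perm_op t \<pi> x)"

definition satisfies_Sigma :: "('a, 'i) alg \<Rightarrow> nat \<Rightarrow> (nat \<Rightarrow> nat) set \<Rightarrow> bool" where
  "satisfies_Sigma A n H \<longleftrightarrow>
     (\<exists>t\<in>clo A n. \<forall>\<pi>\<in>H. \<forall>x\<in>tuples (carrier A) n. t x = perm_op t \<pi> x)"

end

theory Submission
  imports Defs "HOL-Number_Theory.Cong"
begin

text \<open>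
  Let \<open>c\<close> be the fixpoint of \<open>\<alpha>\<close> and \<open>m\<close> the common size of its other cycles, so that
  \<open>2 \<le> m < n\<close> and \<open>n \<equiv> 1 (mod m)\<close>. Numbering the elements of every nontrivial cycle
  consecutively gives a coordinate \<open>u\<close> with \<open>u (\<alpha> j) \<equiv> u j + 1 (mod m)\<close> for \<open>j \<noteq> c\<close>.

  The universe consists of the cyclic group \<open>\<int>\<^sub>m\<close> and of \<open>k + 1\<close> disjoint blocks, each a copy of
  \<open>{1..n}\<close>. On \<open>\<int>\<^sub>m\<close> every basic operation is the sum of its arguments, a symmetric operation that
  is idempotent because \<open>n \<equiv> 1\<close>. On a tuple that leaves \<open>\<int>\<^sub>m\<close>, only the entries outside \<open>\<int>\<^sub>m\<close>
  matter: a single such value is returned unchanged, and otherwise the result is \<open>0\<close>, except that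
  the \<open>i\<close>-th operation, if all these entries are from block \<open>i\<close>, returns the coordinate \<open>u\<close> of
  the first one that is not the copy of \<open>c\<close>.

  Hence the \<open>i\<close>-th operation can fail to be symmetric only on tuples whose entries outside \<open>\<int>\<^sub>m\<close>
  are from block \<open>i\<close>. A tuple can be bad for one \<open>i\<close> only, so for \<open>k\<close> given tuples one of the
  \<open>k + 1\<close> basic operations is symmetric on all of them (\<open>locally_symmetric\<close>).

  To see that no term operation \<open>t\<close> is invariant under \<open>G\<close>, evaluate it on the enumerations \<open>b\<^sub>i\<close>
  of the blocks. By induction (\<open>term_projects_or_shifts\<close>), either \<open>t\<close> acts on all enumerations as one
  fixed projection, or it takes values in \<open>\<int>\<^sub>m\<close> there and the changes \<open>t (b\<^sub>i \<circ> \<alpha>) - t (b\<^sub>i)\<close>,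
  summed over all blocks, give \<open>1\<close>. This total is inherited by sums of \<open>n\<close> such terms since
  \<open>n \<equiv> 1\<close>; and when a basic operation has at least two different projections among its arguments, the total
  arises in just one block, from \<open>u (\<alpha> j) - u j = 1\<close>. For invariant \<open>t\<close> the first alternative makes the
  index of the projection a fixpoint of \<open>G\<close>, and the second one gives \<open>0 \<equiv> 1 (mod m)\<close>.
\<close>

section \<open>A coordinate along the cycles of a permutation\<close>

lemma inj_on_funpow_card_orbit:
  assumes "x \<in> orbit f x"
  shows "inj_on (\<lambda>a. (f ^^ a) x) {0..<card (orbit f x)}"
    and "(f ^^ card (orbit f x)) x = x"
proof -
  let ?d = "funpow_dist1 f x x"
  have inj: "inj_on (\<lambda>a. (f ^^ a) x) {0..<?d}"
    using inj_on_funpow_dist1[OF assms] .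
  have "card (orbit f x) = card ((\<lambda>a. (f ^^ a) x) ` {0..<?d})"
    using orbit_conv_funpow_dist1[OF assms] by simp
  also have "\<dots> = ?d" using card_image[OF inj] by simp
  finally have d: "card (orbit f x) = ?d" .
  show "inj_on (\<lambda>a. (f ^^ a) x) {0..<card (orbit f x)}" using inj d by simp
  show "(f ^^ card (orbit f x)) x = x" using funpow_dist1_prop[OF assms] d by simp
qed

lemma funpow_eq_imp_cong_card_orbit:
  assumes "x \<in> orbit f x" "(f ^^ a) x = (f ^^ b) x"
  shows "[a = b] (mod card (orbit f x))"
proof -
  let ?m = "card (orbit f x)"
  have m: "?m > 0"
    using assms(1) finite_orbit[OF assms(1)] by (auto simp: card_gt_0_iff)
  have per: "(f ^^ (e mod ?m)) x = (f ^^ e) x" for e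
    using funpow_mod_eq[OF inj_on_funpow_card_orbit(2)[OF assms(1)]] .
  have "(f ^^ (a mod ?m)) x = (f ^^ (b mod ?m)) x" using per assms(2) by simp
  then have "a mod ?m = b mod ?m"
    using inj_on_funpow_card_orbit(1)[OF assms(1)] m by (auto simp: inj_on_def)
  then show ?thesis by (simp add: cong_def)
qed

text \<open>
  Choose a root on every cycle and count the steps from the root. The count starts again when the
  cycle closes, which is invisible modulo the length \<open>m\<close> of the cycle.
\<close>
lemma cycle_coordinate_exists:
  assumes "permutation f" and "\<And>x. x \<in> S \<Longrightarrow> f x \<in> S"
    and card: "\<And>x. x \<in> S \<Longrightarrow> card (orbit f x) = m"
  obtains u :: "'a \<Rightarrow> nat" where "\<And>x. x \<in> S \<Longrightarrow> [u (f x) = u x + 1] (mod m)"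
proof
  define root where "root x = (SOME y. y \<in> orbit f x)" for x
  define u where "u x = funpow_dist f (root x) x" for x
  have self: "y \<in> orbit f y" for y using permutation_self_in_orbit[OF assms(1)] .
  have root: "root x \<in> orbit f x" for x
    unfolding root_def using self by (rule someI)
  have orb: "orbit f (root x) = orbit f x" for x
    using orbit_cyclic_eq3[OF cyclic_on_orbit'[OF assms(1)] root] .
  have u: "(f ^^ u x) (root x) = x" for x
    unfolding u_def by (rule funpow_dist_prop) (simp add: orb self)
  fix x assume x: "x \<in> S"
  have "root (f x) = root x"
    \<comment> \<open>The root was chosen from the orbit as a set, and \<open>x\<close> and \<open>f x\<close> have the same orbit.\<close>
    unfolding root_def using permutation_orbit_step[OF assms(1)] by simp
  then have "(f ^^ u (f x)) (root x) = (f ^^ (u x + 1)) (root x)"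
    using u[of "f x"] u[of x] by simp
  then have "[u (f x) = u x + 1] (mod card (orbit f (root x)))"
    by (rule funpow_eq_imp_cong_card_orbit[OF self])
  then show "[u (f x) = u x + 1] (mod m)" using orb card[OF x] by simp
qed

lemma orbit_size_dvd_card:
  assumes "permutation f" and "finite S" and "\<And>x. x \<in> S \<Longrightarrow> orbit f x \<subseteq> S"
    and card: "\<And>x. x \<in> S \<Longrightarrow> card (orbit f x) = m"
  shows "m dvd card S"
proof -
  have self: "y \<in> orbit f y" for y using permutation_self_in_orbit[OF assms(1)] .
  have U: "\<Union> (orbit f ` S) = S" using assms(3) self by auto
  have "m dvd card (\<Union> (orbit f ` S))"
  proof (rule dvd_partition)
    show "finite (\<Union> (orbit f ` S))" using U assms(2) by simp
    show "\<forall>c\<in>orbit f ` S. m dvd card c" using card by auto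
    show "\<forall>c1\<in>orbit f ` S. \<forall>c2\<in>orbit f ` S. c1 \<noteq> c2 \<longrightarrow> c1 \<inter> c2 = {}"
      using orbit_cyclic_eq3[OF cyclic_on_orbit'[OF assms(1)]] by blast
  qed
  then show ?thesis using U by simp
qed

section \<open>The algebra\<close>

text \<open>
  The data extracted from \<open>\<alpha>\<close>. Below, \<open>{..<m}\<close> represents \<open>\<int>\<^sub>m\<close>, and \<open>k + 1\<close> is the number of
  blocks.
\<close>
locale cycle_coordinate =
  fixes n m k c :: nat and \<alpha> :: "nat \<Rightarrow> nat" and u :: "nat \<Rightarrow> nat"
  assumes m_ge_2: "2 \<le> m" and m_less_n: "m < n" and n_cong: "[n = 1] (mod m)"
    and \<alpha>_perm: "\<alpha> permutes {1..n}"
    and c_fix: "\<alpha> c = c"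
    and u_step: "\<And>j. j \<in> {1..n} \<Longrightarrow> j \<noteq> c \<Longrightarrow> [u (\<alpha> j) = u j + 1] (mod m)"
begin

text \<open>
  The copy of \<open>j \<in> {1..n}\<close> in block \<open>i\<close>; the blocks follow each other after \<open>{..<m}\<close>, and the
  shift by one makes them gapless.
\<close>
definition pt :: "nat \<Rightarrow> nat \<Rightarrow> nat" where
  "pt i j = m + i * n + (j - 1)"

text \<open>The inverse of \<open>pt i\<close>, for all \<open>i\<close> at once.\<close>
definition label :: "nat \<Rightarrow> nat" where
  "label y = (y - m) mod n + 1"

definition block :: "nat \<Rightarrow> nat set" where
  "block i = pt i ` {1..n}"

definition outer :: "(nat \<Rightarrow> nat) \<Rightarrow> nat set" where
  "outer x = x ` {1..n} - {..<m}"

text \<open>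
  Selecting an entry by its position makes the choice compatible with applying \<open>\<alpha>\<close> to all labels:
  as \<open>\<alpha>\<close> is a bijection that fixes \<open>c\<close>, the labels different from \<open>c\<close> are in the same positions
  before and after. It is the only ingredient that breaks symmetry.
\<close>
definition first_moved :: "(nat \<Rightarrow> nat) \<Rightarrow> nat" where
  "first_moved x = (LEAST q. q \<in> {1..n} \<and> m \<le> x q \<and> label (x q) \<noteq> c)"

text \<open>
  Returning a lone outer value unchanged serves two purposes: it gives idempotence on the blocks,
  and it lets a projection absorb arguments from \<open>\<int>\<^sub>m\<close>.
\<close>
definition basic_op :: "nat \<Rightarrow> (nat \<Rightarrow> nat) \<Rightarrow> nat" where
  "basic_op i x =
    (if outer x = {} then (\<Sum>q\<in>{1..n}. x q) mod m
     else if is_singleton (outer x) then the_elem (outer x)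
     else if outer x \<subseteq> block i then u (label (x (first_moved x))) mod m
     else 0)"

definition \<A> :: "(nat, nat) alg" where
  "\<A> = \<lparr>carrier = {..<m + (k + 1) * n}, idx = {0..k}, arity = (\<lambda>_. n), op = basic_op\<rparr>"

lemma \<A>_simps [simp]:
  "carrier \<A> = {..<m + (k + 1) * n}" "idx \<A> = {0..k}" "arity \<A> i = n" "op \<A> = basic_op"
  by (simp_all add: \<A>_def)

lemma pt_ge: "m \<le> pt i j"
  by (simp add: pt_def)

lemma label_pt: "j \<in> {1..n} \<Longrightarrow> label (pt i j) = j"
  by (cases j) (auto simp: label_def pt_def)

lemma pt_eq_iff:
  assumes "j \<in> {1..n}" "j' \<in> {1..n}"
  shows "pt i j = pt i' j' \<longleftrightarrow> i = i' \<and> j = j'"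
proof
  assume eq: "pt i j = pt i' j'"
  have quot: "(pt a b - m) div n = a" if "b \<in> {1..n}" for a b
    using that by (cases b) (auto simp: pt_def)
  show "i = i' \<and> j = j'"
    using quot[OF assms(1), of i] quot[OF assms(2), of i'] label_pt[OF assms(1), of i]
      label_pt[OF assms(2), of i'] eq by metis
qed simp

lemma pt_in_carrier:
  assumes "i \<le> k" "j \<in> {1..n}"
  shows "pt i j < m + (k + 1) * n"
proof -
  have "i * n + (j - 1) < (i + 1) * n" using assms(2) by auto
  also have "\<dots> \<le> (k + 1) * n" using assms(1) by (intro mult_right_mono) auto
  finally show ?thesis by (simp add: pt_def)
qed

section \<open>Closure, idempotence and local symmetry\<close>

lemma basic_op_in_carrier:
  assumes "x \<in> tuples (carrier \<A>) n"
  shows "basic_op i x \<in> carrier \<A>"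
proof -
  have mpos: "r mod m < m + (k + 1) * n" for r
    using m_ge_2 by (intro trans_less_add1 mod_less_divisor) auto
  have "outer x \<subseteq> carrier \<A>"
    using assms by (auto simp: outer_def tuples_def PiE_iff)
  then have "the_elem (outer x) \<in> carrier \<A>" if "is_singleton (outer x)"
    using that by (auto elim!: is_singletonE)
  then show ?thesis
    using mpos mpos[of 0] by (auto simp: basic_op_def)
qed

text \<open>On \<open>\<int>\<^sub>m\<close> this is \<open>n * y \<equiv> y\<close>, the place where \<open>n \<equiv> 1\<close> yields idempotence.\<close>
lemma basic_op_const:
  "basic_op i (\<lambda>j\<in>{1..n}. y) = y"
proof (cases "y < m")
  case True
  then have "outer (\<lambda>j\<in>{1..n}. y) = {}" by (auto simp: outer_def)
  moreover have "n * y mod m = y"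
    using cong_scalar_right[OF n_cong, of y] True by (simp add: cong_def)
  ultimately show ?thesis by (simp add: basic_op_def)
next
  case False
  then have "outer (\<lambda>j\<in>{1..n}. y) = {y}"
    using m_less_n by (auto simp: outer_def image_constant_conv)
  then show ?thesis by (simp add: basic_op_def)
qed

lemma outer_permute:
  assumes "\<pi> permutes {1..n}"
  shows "outer (\<lambda>q. x (\<pi> q)) = outer x"
proof -
  have "(\<lambda>q. x (\<pi> q)) ` {1..n} = x ` (\<pi> ` {1..n})" by (simp only: image_image)
  then show ?thesis using permutes_image[OF assms] by (simp add: outer_def)
qed

text \<open>
  The sum and the set of outer values do not see the order of the entries, and the clause that does
  see it applies only inside block \<open>i\<close>.
\<close>
lemma basic_op_symmetric:
  assumes "\<pi> permutes {1..n}" and "outer x = {} \<or> \<not> outer x \<subseteq> block i"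
  shows "basic_op i (\<lambda>q. x (\<pi> q)) = basic_op i x"
proof -
  have "(\<Sum>q\<in>{1..n}. x (\<pi> q)) = (\<Sum>q\<in>{1..n}. x q)"
    using sum.permute[OF assms(1), of x] by (simp add: comp_def)
  then show ?thesis
    using assms(2) by (auto simp: basic_op_def outer_permute[OF assms(1)])
qed

lemma basic_op_in_clo: "i \<le> k \<Longrightarrow> (\<lambda>x\<in>tuples (carrier \<A>) n. basic_op i x) \<in> clo \<A> n"
proof -
  assume i: "i \<le> k"
  let ?s = "\<lambda>j. \<lambda>x\<in>tuples (carrier \<A>) n. x j"
  have "(\<lambda>x\<in>tuples (carrier \<A>) n. op \<A> i (\<lambda>j\<in>{1..arity \<A> i}. ?s j x)) \<in> clo \<A> n"
    using i by (intro clo.comp clo.proj) auto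
  moreover have "(\<lambda>x\<in>tuples (carrier \<A>) n. op \<A> i (\<lambda>j\<in>{1..arity \<A> i}. ?s j x))
      = (\<lambda>x\<in>tuples (carrier \<A>) n. basic_op i x)"
  proof (rule restrict_ext)
    fix x assume x: "x \<in> tuples (carrier \<A>) n"
    then have "(\<lambda>j\<in>{1..n}. ?s j x) = x"
      by (auto simp: tuples_def fun_eq_iff PiE_def extensional_def)
    then show "op \<A> i (\<lambda>j\<in>{1..arity \<A> i}. ?s j x) = basic_op i x" by simp
  qed
  ultimately show ?thesis by simp
qed

lemma tuples_permute:
  assumes "x \<in> tuples S n" "\<pi> permutes {1..n}"
  shows "(\<lambda>q. x (\<pi> q)) \<in> tuples S n"
proof -
  have "x (\<pi> q) \<in> S" if "q \<in> {1..n}" for q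
    using assms permutes_in_image[OF assms(2), of q] that by (auto simp: tuples_def PiE_iff)
  moreover have "x (\<pi> q) = undefined" if "q \<notin> {1..n}" for q
    using assms permutes_not_in[OF assms(2) that] that
    by (auto simp: tuples_def PiE_def extensional_def)
  ultimately show ?thesis by (auto simp: tuples_def PiE_def extensional_def)
qed

lemma block_unique:
  assumes "outer x \<noteq> {}" "outer x \<subseteq> block i" "outer x \<subseteq> block i'"
  shows "i = i'"
proof -
  obtain y where "y \<in> block i" "y \<in> block i'" using assms by blast
  then obtain j j' where "j \<in> {1..n}" "j' \<in> {1..n}" "pt i j = pt i' j'"
    unfolding block_def by (metis imageE)
  then show ?thesis using pt_eq_iff by blast
qed

text \<open>
  Pigeonhole: if each of the \<open>k + 1\<close> operations had a bad tuple in \<open>F\<close>, these tuples would be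
  distinct, since the outer entries of a bad tuple determine the block.
\<close>
lemma locally_symmetric:
  assumes "F \<subseteq> tuples (carrier \<A>) n" "finite F" "card F = k"
  shows "satisfies_Sigma_on \<A> n (carrier (sym_group n)) F"
proof -
  have "\<exists>i\<le>k. \<forall>x\<in>F. outer x = {} \<or> \<not> outer x \<subseteq> block i"
  proof (rule ccontr)
    assume "\<not> ?thesis"
    then have "\<forall>i\<in>{0..k}. \<exists>x\<in>F. outer x \<noteq> {} \<and> outer x \<subseteq> block i" by auto
    then obtain g where g: "\<And>i. i \<le> k \<Longrightarrow> g i \<in> F \<and> outer (g i) \<noteq> {} \<and> outer (g i) \<subseteq> block i"
      by (metis atLeastAtMost_iff zero_le)
    have "inj_on g {0..k}"
      using g block_unique by (intro inj_onI) (metis atLeastAtMost_iff)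
    then have "card {0..k} \<le> card F"
      using g assms(2) by (intro card_inj_on_le[of g]) auto
    then show False using assms(3) by simp
  qed
  then obtain i where i: "i \<le> k" "\<And>x. x \<in> F \<Longrightarrow> outer x = {} \<or> \<not> outer x \<subseteq> block i" by blast
  let ?t = "\<lambda>x\<in>tuples (carrier \<A>) n. basic_op i x"
  have "?t x = perm_op ?t \<pi> x" if "\<pi> \<in> carrier (sym_group n)" "x \<in> F" for \<pi> x
  proof -
    have \<pi>: "\<pi> permutes {1..n}" using that(1) by (simp add: sym_group_carrier)
    have x: "x \<in> tuples (carrier \<A>) n" using that(2) assms(1) by blast
    show ?thesis
      using basic_op_symmetric[OF \<pi> i(2)[OF that(2)]] x tuples_permute[OF x \<pi>]
      by (simp add: perm_op_def)
  qed
  then show ?thesis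
    unfolding satisfies_Sigma_on_def using basic_op_in_clo[OF i(1)] by blast
qed

section \<open>No term is invariant\<close>

definition block_enum :: "nat \<Rightarrow> (nat \<Rightarrow> nat) \<Rightarrow> nat \<Rightarrow> nat" where
  "block_enum i \<pi> = (\<lambda>j\<in>{1..n}. pt i (\<pi> j))"

lemma block_enum_in_tuples:
  assumes "i \<le> k" "\<pi> permutes {1..n}"
  shows "block_enum i \<pi> \<in> tuples (carrier \<A>) n"
  using pt_in_carrier[OF assms(1)] permutes_in_image[OF assms(2)]
  by (auto simp: block_enum_def tuples_def)

text \<open>
  The two kinds of behaviour on enumerations. All \<open>\<pi>\<close> are included since invariance under the
  whole group is needed to exclude projections, and the index \<open>j\<close> must not depend on \<open>\<pi>\<close> or on
  the block. The shift condition says that the changes under \<open>\<alpha>\<close> sum to \<open>1\<close>; a change in an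
  individual block may vanish, as it does for a basic operation in all blocks but its own.
\<close>
definition projects :: "((nat \<Rightarrow> nat) \<Rightarrow> nat) \<Rightarrow> nat \<Rightarrow> bool" where
  "projects t j \<longleftrightarrow> (\<forall>i\<le>k. \<forall>\<pi>. \<pi> permutes {1..n} \<longrightarrow> t (block_enum i \<pi>) = pt i (\<pi> j))"

definition shifts :: "((nat \<Rightarrow> nat) \<Rightarrow> nat) \<Rightarrow> bool" where
  "shifts t \<longleftrightarrow> (\<forall>i\<le>k. \<forall>\<pi>. \<pi> permutes {1..n} \<longrightarrow> t (block_enum i \<pi>) < m) \<and>
     [(\<Sum>i\<le>k. t (block_enum i \<alpha>)) = (\<Sum>i\<le>k. t (block_enum i id)) + 1] (mod m)"

text \<open>
  One step of the induction on terms. The arguments that act as projections occupy the positions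
  \<open>Q\<close> and have the indices \<open>v ` Q\<close>; on an enumeration they produce exactly the outer entries. So
  the number of indices decides between the clauses of \<^const>\<open>basic_op\<close>: none gives a sum in \<open>\<int>\<^sub>m\<close>,
  one gives again a projection, and two or more give \<open>0\<close> in every block other than \<open>i0\<close> and a
  coordinate in block \<open>i0\<close>.
\<close>
lemma term_comp:
  assumes i0: "i0 \<le> k"
    and s: "\<And>q. q \<in> {1..n} \<Longrightarrow> (\<exists>j\<in>{1..n}. projects (s q) j) \<or> shifts (s q)"
    and t: "\<And>x. x \<in> tuples (carrier \<A>) n \<Longrightarrow> t x = basic_op i0 (\<lambda>q\<in>{1..n}. s q x)"
  shows "(\<exists>j\<in>{1..n}. projects t j) \<or> shifts t"
proof -
  define Q where "Q = {q \<in> {1..n}. \<exists>j\<in>{1..n}. projects (s q) j}"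
  have "\<forall>q\<in>Q. \<exists>j\<in>{1..n}. projects (s q) j" by (auto simp: Q_def)
  then obtain v where v: "\<And>q. q \<in> Q \<Longrightarrow> v q \<in> {1..n} \<and> projects (s q) (v q)" by metis
  have Z: "shifts (s q)" if "q \<in> {1..n} - Q" for q using s[of q] that by (auto simp: Q_def)
  define row where "row i \<pi> = (\<lambda>q\<in>{1..n}. s q (block_enum i \<pi>))" for i \<pi>
  have t_enum: "t (block_enum i \<pi>) = basic_op i0 (row i \<pi>)" if "i \<le> k" "\<pi> permutes {1..n}" for i \<pi>
    using t[OF block_enum_in_tuples[OF that]] by (simp add: row_def)
  have row_Q: "row i \<pi> q = pt i (\<pi> (v q))" if "i \<le> k" "\<pi> permutes {1..n}" "q \<in> Q" for i \<pi> q
    using v[OF that(3)] that by (auto simp: row_def projects_def Q_def)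
  have row_Z: "row i \<pi> q < m" if "i \<le> k" "\<pi> permutes {1..n}" "q \<in> {1..n} - Q" for i \<pi> q
    using Z[OF that(3)] that by (auto simp: row_def shifts_def)
  have outer_row: "outer (row i \<pi>) = (\<lambda>j. pt i (\<pi> j)) ` v ` Q"
    if i: "i \<le> k" and \<pi>: "\<pi> permutes {1..n}" for i \<pi>
  proof -
    have small: "row i \<pi> q < m \<longleftrightarrow> q \<notin> Q" if q: "q \<in> {1..n}" for q
      using row_Q[OF i \<pi>, of q] row_Z[OF i \<pi>, of q] q pt_ge[of i "\<pi> (v q)"]
      by (cases "q \<in> Q") auto
    have "outer (row i \<pi>) = row i \<pi> ` Q"
    proof (intro equalityI subsetI)
      fix y assume "y \<in> outer (row i \<pi>)"
      then obtain q where "q \<in> {1..n}" "y = row i \<pi> q" "\<not> row i \<pi> q < m"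
        by (auto simp: outer_def)
      then show "y \<in> row i \<pi> ` Q" using small by blast
    next
      fix y assume "y \<in> row i \<pi> ` Q"
      then obtain q where "q \<in> Q" "y = row i \<pi> q" by blast
      moreover from this have "q \<in> {1..n}" by (simp add: Q_def)
      ultimately show "y \<in> outer (row i \<pi>)" using small by (auto simp: outer_def)
    qed
    also have "\<dots> = (\<lambda>j. pt i (\<pi> j)) ` v ` Q"
      unfolding image_image using row_Q[OF i \<pi>] by (intro image_cong) auto
    finally show ?thesis .
  qed
  have inj: "inj_on (\<lambda>j. pt i (\<pi> j)) (v ` Q)" if "\<pi> permutes {1..n}" for i \<pi>
  proof (rule inj_onI)
    fix j j' assume "j \<in> v ` Q" "j' \<in> v ` Q" and eq: "pt i (\<pi> j) = pt i (\<pi> j')"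
    then have "j \<in> {1..n}" "j' \<in> {1..n}" using v by auto
    then have "\<pi> j = \<pi> j'"
      using eq pt_eq_iff permutes_in_image[OF that] by blast
    then show "j = j'" using permutes_inj[OF that] by (auto dest: injD)
  qed
  consider "v ` Q = {}" | j where "v ` Q = {j}" | "v ` Q \<noteq> {}" "\<not> is_singleton (v ` Q)"
    by (auto simp: is_singleton_def)
  then show ?thesis
  proof cases
    case 1
    then have Q: "Q = {}" by simp
    have val: "t (block_enum i \<pi>) = (\<Sum>q\<in>{1..n}. s q (block_enum i \<pi>)) mod m"
      if "i \<le> k" "\<pi> permutes {1..n}" for i \<pi>
      using outer_row[OF that] t_enum[OF that] 1 by (simp add: basic_op_def row_def)
    have swap: "[(\<Sum>i\<le>k. t (block_enum i \<pi>)) = (\<Sum>q\<in>{1..n}. \<Sum>i\<le>k. s q (block_enum i \<pi>))] (mod m)"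
      if "\<pi> permutes {1..n}" for \<pi>
    proof -
      have "[(\<Sum>i\<le>k. t (block_enum i \<pi>)) = (\<Sum>i\<le>k. \<Sum>q\<in>{1..n}. s q (block_enum i \<pi>))] (mod m)"
        using val that by (intro cong_sum) (simp add: cong_def)
      also have "(\<Sum>i\<le>k. \<Sum>q\<in>{1..n}. s q (block_enum i \<pi>)) = (\<Sum>q\<in>{1..n}. \<Sum>i\<le>k. s q (block_enum i \<pi>))"
        by (rule sum.swap)
      finally show ?thesis .
    qed
    \<comment> \<open>Each of the \<open>n\<close> summands contributes \<open>1\<close> to the total change, and \<open>n \<equiv> 1\<close>.\<close>
    have "[(\<Sum>i\<le>k. t (block_enum i \<alpha>)) = (\<Sum>q\<in>{1..n}. \<Sum>i\<le>k. s q (block_enum i \<alpha>))] (mod m)"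
      by (rule swap[OF \<alpha>_perm])
    also have "[(\<Sum>q\<in>{1..n}. \<Sum>i\<le>k. s q (block_enum i \<alpha>)) =
        (\<Sum>q\<in>{1..n}. (\<Sum>i\<le>k. s q (block_enum i id)) + 1)] (mod m)"
      using Z Q by (intro cong_sum) (auto simp: shifts_def)
    also have "(\<Sum>q\<in>{1..n}. (\<Sum>i\<le>k. s q (block_enum i id)) + 1) =
        (\<Sum>q\<in>{1..n}. \<Sum>i\<le>k. s q (block_enum i id)) + n"
      by (simp only: sum.distrib) simp
    also have "[(\<Sum>q\<in>{1..n}. \<Sum>i\<le>k. s q (block_enum i id)) + n = (\<Sum>i\<le>k. t (block_enum i id)) + 1] (mod m)"
      using cong_sym[OF swap[OF permutes_id]] n_cong by (rule cong_add)
    finally have "[(\<Sum>i\<le>k. t (block_enum i \<alpha>)) = (\<Sum>i\<le>k. t (block_enum i id)) + 1] (mod m)" .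
    moreover have "t (block_enum i \<pi>) < m" if "i \<le> k" "\<pi> permutes {1..n}" for i \<pi>
      using val[OF that] m_ge_2 by simp
    ultimately show ?thesis by (simp add: shifts_def)
  next
    case 2
    have "projects t j"
      unfolding projects_def
    proof safe
      fix i \<pi> assume i: "i \<le> k" and \<pi>: "\<pi> permutes {1..n}"
      have "outer (row i \<pi>) = {pt i (\<pi> j)}" using outer_row[OF i \<pi>] 2 by simp
      then show "t (block_enum i \<pi>) = pt i (\<pi> j)" using t_enum[OF i \<pi>] by (simp add: basic_op_def)
    qed
    moreover have "j \<in> v ` Q" using 2 by simp
    then have "j \<in> {1..n}" using v by auto
    ultimately show ?thesis by blast
  next
    case 3
    have nonsing: "outer (row i \<pi>) \<noteq> {} \<and> \<not> is_singleton (outer (row i \<pi>))"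
      if "i \<le> k" "\<pi> permutes {1..n}" for i \<pi>
      using 3 unfolding outer_row[OF that] is_singleton_altdef card_image[OF inj[OF that(2)]]
      by blast
    have sub: "outer (row i \<pi>) \<subseteq> block i" if "i \<le> k" "\<pi> permutes {1..n}" for i \<pi>
      using outer_row[OF that] v permutes_in_image[OF that(2)] by (auto simp: block_def)
    have off: "t (block_enum i \<pi>) = 0" if "i \<le> k" "\<pi> permutes {1..n}" "i \<noteq> i0" for i \<pi>
      using nonsing[OF that(1,2)] sub[OF that(1,2)] block_unique[of "row i \<pi>" i i0] that(3)
      by (auto simp: t_enum[OF that(1,2)] basic_op_def)
    have on: "t (block_enum i0 \<pi>) = u (label (row i0 \<pi> (first_moved (row i0 \<pi>)))) mod m"
      if "\<pi> permutes {1..n}" for \<pi>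
      using nonsing[OF i0 that] sub[OF i0 that] by (auto simp: t_enum[OF i0 that] basic_op_def)
    define p where "p = (LEAST q. q \<in> Q \<and> v q \<noteq> c)"
    \<comment> \<open>Two different indices cannot both be \<open>c\<close>, so there is an entry that \<open>\<alpha>\<close> moves.\<close>
    have "\<exists>q. q \<in> Q \<and> v q \<noteq> c"
    proof (rule ccontr)
      assume "\<not> ?thesis"
      then have "v ` Q \<subseteq> {c}" by auto
      then show False using 3 by (auto simp: is_singleton_def subset_singleton_iff)
    qed
    then have p: "p \<in> Q" "v p \<noteq> c" unfolding p_def by (metis (mono_tags, lifting) LeastI)+
    \<comment> \<open>As \<open>\<pi>\<close> fixes \<open>c\<close>, it changes no comparison with \<open>c\<close>: \<open>id\<close> and \<open>\<alpha>\<close> select the same position.\<close>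
    have moved: "label (row i0 \<pi> (first_moved (row i0 \<pi>))) = \<pi> (v p)"
      if \<pi>: "\<pi> permutes {1..n}" and fix_c: "\<pi> c = c" for \<pi>
    proof -
      have lab: "m \<le> row i0 \<pi> q \<and> label (row i0 \<pi> q) = \<pi> (v q)" if "q \<in> Q" for q
        using row_Q[OF i0 \<pi> that] v[OF that] permutes_in_image[OF \<pi>] label_pt pt_ge by simp
      have "q \<in> {1..n} \<and> m \<le> row i0 \<pi> q \<and> label (row i0 \<pi> q) \<noteq> c \<longleftrightarrow> q \<in> Q \<and> v q \<noteq> c" for q
      proof (cases "q \<in> Q")
        case True
        then have "\<pi> (v q) = c \<longleftrightarrow> v q = c"
          using permutes_inj[OF \<pi>] fix_c by (metis injD)
        then show ?thesis using lab[OF True] True by (auto simp: Q_def)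
      next
        case False
        then show ?thesis using row_Z[OF i0 \<pi>, of q] by auto
      qed
      then have "first_moved (row i0 \<pi>) = p" by (simp add: first_moved_def p_def)
      then show ?thesis using lab[OF p(1)] by simp
    qed
    have split: "(\<Sum>i\<le>k. t (block_enum i \<pi>)) = t (block_enum i0 \<pi>)" if "\<pi> permutes {1..n}" for \<pi>
    proof -
      have "(\<Sum>i\<le>k. t (block_enum i \<pi>)) = (\<Sum>i\<in>{i0}. t (block_enum i \<pi>))"
        using i0 off that by (intro sum.mono_neutral_right) auto
      then show ?thesis by simp
    qed
    have "t (block_enum i0 \<alpha>) = u (\<alpha> (v p)) mod m"
      using on[OF \<alpha>_perm] moved[OF \<alpha>_perm c_fix] by simp
    moreover have "t (block_enum i0 id) = u (v p) mod m"
      using on[OF permutes_id] moved[OF permutes_id] by simp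
    ultimately have "[t (block_enum i0 \<alpha>) = t (block_enum i0 id) + 1] (mod m)"
      using u_step[of "v p"] v[OF p(1)] p(2) by (simp add: cong_def mod_Suc_eq)
    moreover have "t (block_enum i \<pi>) < m" if "i \<le> k" "\<pi> permutes {1..n}" for i \<pi>
      using on[OF that(2)] off[OF that] m_ge_2 by (cases "i = i0") auto
    ultimately have "shifts t"
      using split[OF \<alpha>_perm] split[OF permutes_id] by (simp add: shifts_def)
    then show ?thesis by blast
  qed
qed

lemma term_projects_or_shifts:
  assumes "t \<in> clo \<A> n"
  shows "(\<exists>j\<in>{1..n}. projects t j) \<or> shifts t"
  using assms
proof induction
  case (proj j)
  have "projects (\<lambda>x\<in>tuples (carrier \<A>) n. x j) j"
    unfolding projects_def
  proof safe
    fix i \<pi> assume "i \<le> k" "\<pi> permutes {1..n}"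
    from block_enum_in_tuples[OF this] proj
    show "(\<lambda>x\<in>tuples (carrier \<A>) n. x j) (block_enum i \<pi>) = pt i (\<pi> j)"
      by (simp add: block_enum_def)
  qed
  then show ?case using proj by blast
next
  case (comp i s)
  show ?case
  proof (rule term_comp)
    show "i \<le> k" using comp.hyps(1) by simp
    show "(\<exists>j\<in>{1..n}. projects (s q) j) \<or> shifts (s q)" if "q \<in> {1..n}" for q
      using comp.IH[of q] that by simp
  qed simp
qed

lemma not_invariant:
  assumes G: "G \<subseteq> carrier (sym_group n)" and "\<alpha> \<in> G"
    and no_fix: "\<not> (\<exists>j\<in>{1..n}. \<forall>\<pi>\<in>G. \<pi> j = j)"
  shows "\<not> satisfies_Sigma \<A> n G"
proof
  assume "satisfies_Sigma \<A> n G"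
  then obtain t where t: "t \<in> clo \<A> n"
    and inv: "\<And>\<pi> x. \<pi> \<in> G \<Longrightarrow> x \<in> tuples (carrier \<A>) n \<Longrightarrow> t x = perm_op t \<pi> x"
    unfolding satisfies_Sigma_def by blast
  have G': "\<pi> permutes {1..n}" if "\<pi> \<in> G" for \<pi>
    using G that by (auto simp: sym_group_carrier)
  have same: "t (block_enum i \<pi>) = t (block_enum i id)" if "i \<le> k" "\<pi> \<in> G" for i \<pi>
  proof -
    have "(\<lambda>q. block_enum i id (\<pi> q)) = block_enum i \<pi>"
      using permutes_in_image[OF G'[OF that(2)]] permutes_not_in[OF G'[OF that(2)]]
      by (auto simp: block_enum_def fun_eq_iff)
    then show ?thesis
      using inv[OF that(2) block_enum_in_tuples[OF that(1) permutes_id]] by (simp add: perm_op_def)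
  qed
  from term_projects_or_shifts[OF t] show False
  proof
    assume "\<exists>j\<in>{1..n}. projects t j"
    then obtain j where j: "j \<in> {1..n}" and pr: "projects t j" by blast
    have "\<pi> j = j" if "\<pi> \<in> G" for \<pi>
    proof -
      have "pt 0 (\<pi> j) = pt 0 j"
        using pr same[of 0 \<pi>] that G'[OF that] permutes_id[of "{1..n}"]
        by (simp add: projects_def)
      then show ?thesis
        using pt_eq_iff j permutes_in_image[OF G'[OF that]] by blast
    qed
    then show False using no_fix j by blast
  next
    assume sh: "shifts t"
    have "(\<Sum>i\<le>k. t (block_enum i \<alpha>)) = (\<Sum>i\<le>k. t (block_enum i id))"
      using same[OF _ \<open>\<alpha> \<in> G\<close>] by (intro sum.cong) auto
    with sh have "[0 + (\<Sum>i\<le>k. t (block_enum i id)) = 1 + (\<Sum>i\<le>k. t (block_enum i id))] (mod m)"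
      by (simp add: shifts_def)
    then have "[0 = 1] (mod m)" by (simp only: cong_add_rcancel_nat)
    then show False using m_ge_2 by (simp add: cong_def)
  qed
qed

end

section \<open>Extracting the coordinate from the permutation group\<close>

theorem theorem17:
  fixes n :: nat and G :: "(nat \<Rightarrow> nat) set" and \<alpha> :: "nat \<Rightarrow> nat"
  assumes "subgroup G (sym_group n)"
    and "\<not> (\<exists>i\<in>{1..n}. \<forall>\<pi>\<in>G. \<pi> i = i)"
    and "\<alpha> \<in> G"
    and "\<exists>!i. i \<in> {1..n} \<and> \<alpha> i = i"
    and "\<forall>i\<in>{1..n}. \<forall>j\<in>{1..n}. \<alpha> i \<noteq> i \<longrightarrow> \<alpha> j \<noteq> j \<longrightarrow>
           card (orbit \<alpha> i) = card (orbit \<alpha> j)"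
  shows "\<forall>k::nat. \<exists>A :: (nat, nat) alg.
           is_algebra A \<and>
           idx A = {0..k} \<and> (\<forall>i\<in>{0..k}. arity A i = n) \<and>
           (k + 1) * n < card (carrier A) \<and> card (carrier A) < (k + 2) * n \<and>
           is_idempotent A \<and>
           (\<forall>F. F \<subseteq> tuples (carrier A) n \<and> finite F \<and> card F = k \<longrightarrow>
              satisfies_Sigma_on A n (carrier (sym_group n)) F) \<and>
           \<not> satisfies_Sigma A n G"
proof
  fix k :: nat
  have G: "G \<subseteq> carrier (sym_group n)" using assms(1) by (rule subgroup.subset)
  have perm: "\<alpha> permutes {1..n}" using G assms(3) by (auto simp: sym_group_carrier)
  then have permutation: "permutation \<alpha>" by (auto simp: permutation_permutes)
  obtain c where c: "c \<in> {1..n}" "\<alpha> c = c" using assms(4) by blast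
  have moved: "\<alpha> j \<noteq> j" if "j \<in> {1..n}" "j \<noteq> c" for j using assms(4) c that by blast
  \<comment> \<open>Some element of \<open>G\<close> moves \<open>c\<close>; its image lies on a nontrivial cycle of \<open>\<alpha>\<close>.\<close>
  obtain \<pi> where \<pi>: "\<pi> \<in> G" "\<pi> c \<noteq> c" using assms(2) c(1) by blast
  then have "\<pi> permutes {1..n}" using G by (auto simp: sym_group_carrier)
  then have d: "\<pi> c \<in> {1..n}" using c(1) by (simp only: permutes_in_image)
  define S where "S = {1..n} - {c}"
  define m where "m = card (orbit \<alpha> (\<pi> c))"
  have size: "card (orbit \<alpha> j) = m" if "j \<in> S" for j
    using assms(5) moved that d \<pi>(2) unfolding S_def m_def by blast
  have "\<alpha> permutes S"
    using perm c(2) unfolding S_def by (auto simp: permutes_def)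
  then have closed: "orbit \<alpha> j \<subseteq> S" if "j \<in> S" for j
    using permutes_orbit_subset that by metis
  have dS: "\<pi> c \<in> S" using d \<pi>(2) by (simp add: S_def)
  have card_S: "card S = n - 1" using c(1) by (simp add: S_def)
  have "m \<le> card S" unfolding m_def
    using closed[OF dS] by (intro card_mono) (auto simp: S_def)
  moreover have "n \<ge> 1" using c(1) by simp
  ultimately have "m < n" using card_S by simp
  have "m dvd n - 1"
    using orbit_size_dvd_card[OF permutation _ closed size] card_S by (simp add: S_def)
  then have n_cong: "[n = 1] (mod m)"
    using \<open>n \<ge> 1\<close> cong_altdef_nat[of 1 n m] by (simp add: cong_sym_eq)
  have "2 \<le> m"
  proof -
    have "{\<pi> c, \<alpha> (\<pi> c)} \<subseteq> orbit \<alpha> (\<pi> c)"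
      using permutation_self_in_orbit[OF permutation] by (auto intro: orbit.base)
    then have "card {\<pi> c, \<alpha> (\<pi> c)} \<le> m" unfolding m_def
      using finite_orbit[OF permutation_self_in_orbit[OF permutation]] by (intro card_mono) auto
    then show ?thesis using moved[OF d \<pi>(2)] by simp
  qed
  obtain u where u: "\<And>j. j \<in> S \<Longrightarrow> [u (\<alpha> j) = u j + 1] (mod m)"
    using cycle_coordinate_exists[OF permutation _ size] closed orbit.base by (metis subsetD)
  interpret cycle_coordinate n m k c \<alpha> u
    using \<open>2 \<le> m\<close> \<open>m < n\<close> n_cong perm c u by unfold_locales (auto simp: S_def)
  have "is_algebra \<A>"
    using basic_op_in_carrier \<open>m < n\<close> by (auto simp: is_algebra_def lessThan_empty_iff)
  moreover have "is_idempotent \<A>"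
    using basic_op_const by (simp add: is_idempotent_def)
  ultimately show "\<exists>A :: (nat, nat) alg.
           is_algebra A \<and>
           idx A = {0..k} \<and> (\<forall>i\<in>{0..k}. arity A i = n) \<and>
           (k + 1) * n < card (carrier A) \<and> card (carrier A) < (k + 2) * n \<and>
           is_idempotent A \<and>
           (\<forall>F. F \<subseteq> tuples (carrier A) n \<and> finite F \<and> card F = k \<longrightarrow>
              satisfies_Sigma_on A n (carrier (sym_group n)) F) \<and>
           \<not> satisfies_Sigma A n G"
    using locally_symmetric not_invariant[OF G assms(3,2)] \<open>2 \<le> m\<close> \<open>m < n\<close>
    by (intro exI[of _ \<A>]) simp
qed

end
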